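(* For every $k\in\mathbb{N}$, \[ N_{\mathrm{FO}_k}\le \mathrm{twr}\bigl(k+\log^*(k^2+k)+1\bigr)\quad\text{and}\quad N_{\mathrm{MSO}_k}\le \mathrm{twr}\bigl(k+\log^*((k+1)^2)+1\bigr). \]
   Context: Words are nonempty finite words over the alphabet $\Sigma=\{l,r\}$; a word is identified with its word model: the finite structure whose domain is the set of positions, with the linear order $<$ and unary predicates $P_l,P_r$ marking the positions carrying $l$ and $r$. All formulas of first-order logic FO and monadic second-order logic MSO are over the vocabulary $\{<,P_l,P_r\}$. The quantifier rank $\mathrm{qr}$ is defined by: $\mathrm{qr}=0$ for atomic formulas, $\mathrm{qr}(\neg\psi)=\mathrm{qr}(\psi)$, $\mathrm{qr}(\psi\wedge\theta)=\mathrm{qr}(\psi\vee\theta)=\max(\mathrm{qr}(\psi),\mathrm{qr}(\theta))$, and each first- or second-order quantifier adds $1$. $\mathrm{FO}_k$ (resp. $\mathrm{MSO}_k$) is the set of FO (resp. MSO) formulas of quantifier rank at most $k$. For a fragment $L$, words $w,v$ satisfy $w\equiv_L v$ if they satisfy the same $L$-sentences; $N_L$ denotes the number of $\equiv_L$-equivalence classes on $\Sigma$-words. $\mathrm{tower}(0)=1$, $\mathrm{tower}(n+1)=2^{\mathrm{tower}(n)}$; for real $x\ge 0$, $\mathrm{twr}(x)=\mathrm{tower}(\lceil x\rceil)$; for real $x\ge1$, $\log^*(x)$ is the least $m\in\mathbb{N}$ with $\mathrm{tower}(m)\ge x$. *)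

theory Defs
  imports Complex_Main
begin

datatype letter = L | R

definition words :: "letter list set" where
  "words = {w. w \<noteq> []}"

text \<open>
  MSO formulas over the vocabulary \<open><, P\<^sub>l, P\<^sub>r\<close> with equality. First-order variables and
  set variables are two separate sorts, each with names in \<^typ>\<open>nat\<close>.
  \<open>Pred a x\<close> is \<open>P\<^sub>a(x)\<close> and \<open>Mem x X\<close> is \<open>X(x)\<close>.
\<close>

datatype fm =
    Eq nat nat
  | Less nat nat
  | Pred letter nat
  | Mem nat nat
  | Neg fm
  | Conj fm fm
  | Disj fm fm
  | Ex nat fm
  | All nat fm
  | ExSet nat fm
  | AllSet nat fm

primrec qr :: "fm \<Rightarrow> nat" where
  "qr (Eq x y) = 0"
| "qr (Less x y) = 0"
| "qr (Pred a x) = 0"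
| "qr (Mem x X) = 0"
| "qr (Neg \<phi>) = qr \<phi>"
| "qr (Conj \<phi> \<psi>) = max (qr \<phi>) (qr \<psi>)"
| "qr (Disj \<phi> \<psi>) = max (qr \<phi>) (qr \<psi>)"
| "qr (Ex x \<phi>) = qr \<phi> + 1"
| "qr (All x \<phi>) = qr \<phi> + 1"
| "qr (ExSet X \<phi>) = qr \<phi> + 1"
| "qr (AllSet X \<phi>) = qr \<phi> + 1"

primrec first_order :: "fm \<Rightarrow> bool" where
  "first_order (Eq x y) = True"
| "first_order (Less x y) = True"
| "first_order (Pred a x) = True"
| "first_order (Mem x X) = False"
| "first_order (Neg \<phi>) = first_order \<phi>"
| "first_order (Conj \<phi> \<psi>) = (first_order \<phi> \<and> first_order \<psi>)"
| "first_order (Disj \<phi> \<psi>) = (first_order \<phi> \<and> first_order \<psi>)"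
| "first_order (Ex x \<phi>) = first_order \<phi>"
| "first_order (All x \<phi>) = first_order \<phi>"
| "first_order (ExSet X \<phi>) = False"
| "first_order (AllSet X \<phi>) = False"

primrec free_vars :: "fm \<Rightarrow> nat set" where
  "free_vars (Eq x y) = {x, y}"
| "free_vars (Less x y) = {x, y}"
| "free_vars (Pred a x) = {x}"
| "free_vars (Mem x X) = {x}"
| "free_vars (Neg \<phi>) = free_vars \<phi>"
| "free_vars (Conj \<phi> \<psi>) = free_vars \<phi> \<union> free_vars \<psi>"
| "free_vars (Disj \<phi> \<psi>) = free_vars \<phi> \<union> free_vars \<psi>"
| "free_vars (Ex x \<phi>) = free_vars \<phi> - {x}"
| "free_vars (All x \<phi>) = free_vars \<phi> - {x}"
| "free_vars (ExSet X \<phi>) = free_vars \<phi>"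
| "free_vars (AllSet X \<phi>) = free_vars \<phi>"

primrec free_set_vars :: "fm \<Rightarrow> nat set" where
  "free_set_vars (Eq x y) = {}"
| "free_set_vars (Less x y) = {}"
| "free_set_vars (Pred a x) = {}"
| "free_set_vars (Mem x X) = {X}"
| "free_set_vars (Neg \<phi>) = free_set_vars \<phi>"
| "free_set_vars (Conj \<phi> \<psi>) = free_set_vars \<phi> \<union> free_set_vars \<psi>"
| "free_set_vars (Disj \<phi> \<psi>) = free_set_vars \<phi> \<union> free_set_vars \<psi>"
| "free_set_vars (Ex x \<phi>) = free_set_vars \<phi>"
| "free_set_vars (All x \<phi>) = free_set_vars \<phi>"
| "free_set_vars (ExSet X \<phi>) = free_set_vars \<phi> - {X}"
| "free_set_vars (AllSet X \<phi>) = free_set_vars \<phi> - {X}"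

definition sentence :: "fm \<Rightarrow> bool" where
  "sentence \<phi> \<longleftrightarrow> free_vars \<phi> = {} \<and> free_set_vars \<phi> = {}"

text \<open>
  The domain of the word model of \<open>w\<close> is the set of positions \<open>{..<length w}\<close>. Positions outside
  of it are only reachable through the initial values of free variables.
\<close>

primrec sat :: "letter list \<Rightarrow> (nat \<Rightarrow> nat) \<Rightarrow> (nat \<Rightarrow> nat set) \<Rightarrow> fm \<Rightarrow> bool" where
  "sat w I J (Eq x y) \<longleftrightarrow> I x = I y"
| "sat w I J (Less x y) \<longleftrightarrow> I x < I y"
| "sat w I J (Pred a x) \<longleftrightarrow> w ! I x = a"
| "sat w I J (Mem x X) \<longleftrightarrow> I x \<in> J X"
| "sat w I J (Neg \<phi>) \<longleftrightarrow> \<not> sat w I J \<phi>"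
| "sat w I J (Conj \<phi> \<psi>) \<longleftrightarrow> sat w I J \<phi> \<and> sat w I J \<psi>"
| "sat w I J (Disj \<phi> \<psi>) \<longleftrightarrow> sat w I J \<phi> \<or> sat w I J \<psi>"
| "sat w I J (Ex x \<phi>) \<longleftrightarrow> (\<exists>i<length w. sat w (I(x := i)) J \<phi>)"
| "sat w I J (All x \<phi>) \<longleftrightarrow> (\<forall>i<length w. sat w (I(x := i)) J \<phi>)"
| "sat w I J (ExSet X \<phi>) \<longleftrightarrow> (\<exists>S\<subseteq>{..<length w}. sat w I (J(X := S)) \<phi>)"
| "sat w I J (AllSet X \<phi>) \<longleftrightarrow> (\<forall>S\<subseteq>{..<length w}. sat w I (J(X := S)) \<phi>)"

lemma sat_cong:
  assumes "\<And>x. x \<in> free_vars \<phi> \<Longrightarrow> I x = I' x"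
    and "\<And>X. X \<in> free_set_vars \<phi> \<Longrightarrow> J X = J' X"
  shows "sat w I J \<phi> \<longleftrightarrow> sat w I' J' \<phi>"
  using assms
proof (induction \<phi> arbitrary: I I' J J')
  case (Ex x \<phi>)
  have "sat w (I(x := i)) J \<phi> \<longleftrightarrow> sat w (I'(x := i)) J' \<phi>" for i
    by (rule Ex.IH) (use Ex.prems in auto)
  then show ?case by simp
next
  case (All x \<phi>)
  have "sat w (I(x := i)) J \<phi> \<longleftrightarrow> sat w (I'(x := i)) J' \<phi>" for i
    by (rule All.IH) (use All.prems in auto)
  then show ?case by simp
next
  case (ExSet X \<phi>)
  have "sat w I (J(X := S)) \<phi> \<longleftrightarrow> sat w I' (J'(X := S)) \<phi>" for S
    by (rule ExSet.IH) (use ExSet.prems in auto)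
  then show ?case by simp
next
  case (AllSet X \<phi>)
  have "sat w I (J(X := S)) \<phi> \<longleftrightarrow> sat w I' (J'(X := S)) \<phi>" for S
    by (rule AllSet.IH) (use AllSet.prems in auto)
  then show ?case by simp
next
  case (Neg \<phi>)
  have "sat w I J \<phi> \<longleftrightarrow> sat w I' J' \<phi>"
    by (rule Neg.IH) (use Neg.prems in auto)
  then show ?case by simp
next
  case (Conj \<phi> \<psi>)
  have "sat w I J \<phi> \<longleftrightarrow> sat w I' J' \<phi>"
    by (rule Conj.IH(1)) (use Conj.prems in auto)
  moreover have "sat w I J \<psi> \<longleftrightarrow> sat w I' J' \<psi>"
    by (rule Conj.IH(2)) (use Conj.prems in auto)
  ultimately show ?case by simp
next
  case (Disj \<phi> \<psi>)
  have "sat w I J \<phi> \<longleftrightarrow> sat w I' J' \<phi>"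
    by (rule Disj.IH(1)) (use Disj.prems in auto)
  moreover have "sat w I J \<psi> \<longleftrightarrow> sat w I' J' \<psi>"
    by (rule Disj.IH(2)) (use Disj.prems in auto)
  ultimately show ?case by simp
qed auto

text \<open>The assignment is immaterial for sentences, see \<open>models_iff_sat\<close> below.\<close>

definition models :: "letter list \<Rightarrow> fm \<Rightarrow> bool" where
  "models w \<phi> \<longleftrightarrow> sat w (\<lambda>_. 0) (\<lambda>_. {}) \<phi>"

lemma models_iff_sat: "sentence \<phi> \<Longrightarrow> models w \<phi> \<longleftrightarrow> sat w I J \<phi>"
  unfolding models_def sentence_def by (rule sat_cong) auto

definition FO :: "nat \<Rightarrow> fm set" where
  "FO k = {\<phi>. first_order \<phi> \<and> qr \<phi> \<le> k}"

definition MSO :: "nat \<Rightarrow> fm set" where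
  "MSO k = {\<phi>. qr \<phi> \<le> k}"

definition equiv_rel :: "fm set \<Rightarrow> (letter list \<times> letter list) set" where
  "equiv_rel F = {(w, v). w \<in> words \<and> v \<in> words \<and>
     (\<forall>\<phi>\<in>F. sentence \<phi> \<longrightarrow> (models w \<phi> \<longleftrightarrow> models v \<phi>))}"

lemma equiv_equiv_rel: "equiv words (equiv_rel F)"
  by (rule equivI) (auto simp: equiv_rel_def refl_on_def sym_def trans_def)

definition classes :: "fm set \<Rightarrow> letter list set set" where
  "classes F = words // equiv_rel F"

text \<open>
  \<^const>\<open>card\<close> is \<open>0\<close> on infinite sets, so an upper bound on \<open>num_classes F\<close> is meaningful only
  together with \<open>finite (classes F)\<close>.
\<close>

definition num_classes :: "fm set \<Rightarrow> nat" where
  "num_classes F = card (classes F)"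

primrec tower :: "nat \<Rightarrow> nat" where
  "tower 0 = 1"
| "tower (Suc n) = 2 ^ tower n"

definition twr :: "real \<Rightarrow> nat" where
  "twr x = tower (nat \<lceil>x\<rceil>)"

text \<open>For \<open>x < 1\<close> this definition gives \<open>log_star x = 0\<close>.\<close>

definition log_star :: "real \<Rightarrow> nat" where
  "log_star x = (LEAST m. real (tower m) \<ge> x)"

end

theory Submission
  imports Defs "HOL-Library.Nat_Bijection"
begin

text \<open>
  The rank-\<open>(n + 1)\<close> type of a word with distinguished objects is the set of rank-\<open>n\<close> types of all
  extensions by one more object, so each quantifier costs one exponential, and the rank-\<open>0\<close> type
  of \<open>k\<close> objects is a set of truth values of atoms. For MSO only sets are distinguished and an
  element is treated as a singleton. One bit per pair of objects then suffices: it means order if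
  both are singletons, and membership if only the first one is. Together with one bit for the
  letter and one for being a singleton, this makes \<open>k\<^sup>2 + 2 k\<close> bits; for FO all objects are
  singletons and \<open>k\<^sup>2 + k\<close> bits remain. Types are coded as natural numbers, a finite set of codes
  being coded in binary.
\<close>

section \<open>Number codes for types\<close>

lemma set_encode_less_two_power:
  assumes "A \<subseteq> {..<n}"
  shows "set_encode A < 2 ^ n"
proof -
  have "set_encode A \<le> (\<Sum>i<n. 2 ^ i)"
    unfolding set_encode_def using assms by (intro sum_mono2) auto
  also have "\<dots> < 2 ^ n"
    by (simp flip: mask_eq_sum_exp_nat add: lessThan_def)
  finally show ?thesis .
qed

text \<open>\<open>D n\<close> lists the objects that may be distinguished in a word of length
  \<open>n\<close>, and \<open>c\<close> is the number of bits stored per object: \<open>k\<close>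
  for its pairings, one for its letter (present as \<open>k < c\<close>) and, if
  \<open>Suc k < c\<close>, one telling whether it is a singleton. The last assumption says that
  without this bit all objects are singletons anyway.\<close>

locale object_types =
  fixes D :: "nat \<Rightarrow> nat set set" and k c :: nat
  assumes D_subset: "S \<in> D n \<Longrightarrow> S \<subseteq> {..<n}"
    and singleton_in_D: "i < n \<Longrightarrow> {i} \<in> D n"
    and k_less_c: "k < c"
    and singleton_determined: "Suc k < c \<or> (\<forall>n. \<forall>S\<in>D n. is_singleton S)"
begin

text \<open>If \<open>Ss ! i\<close> is not a singleton, \<open>the_elem (Ss ! i)\<close> is an
  unspecified value and the bits with j \<le> k carry no information. The arguments below read them
  only where the object is a singleton in both words.\<close>

definition atom :: "letter list \<Rightarrow> nat set list \<Rightarrow> nat \<Rightarrow> nat \<Rightarrow> bool" where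
  "atom w Ss i j \<longleftrightarrow>
    (if j < k then if is_singleton (Ss ! j) then the_elem (Ss ! i) < the_elem (Ss ! j)
                   else the_elem (Ss ! i) \<in> Ss ! j
     else if j = k then w ! the_elem (Ss ! i) = L
     else is_singleton (Ss ! i))"

primrec ty :: "nat \<Rightarrow> letter list \<Rightarrow> nat set list \<Rightarrow> nat" where
  "ty 0 w Ss = set_encode {q. q < k * c \<and> atom w Ss (q div c) (q mod c)}"
| "ty (Suc n) w Ss = set_encode ((\<lambda>S. ty n w (Ss @ [S])) ` D (length w))"

text \<open>At rank 0 there are \<open>k * c\<close> bits, so the code lies below one exponential of
  \<open>tower (l - 1)\<close>. A set of codes below \<open>tower (n + l)\<close> is a bit string of
  that length, which adds one storey per rank.\<close>

lemma ty_less: "l \<ge> 1 \<Longrightarrow> k * c \<le> tower (l - 1) \<Longrightarrow> ty n w Ss < tower (n + l)"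
proof (induction n arbitrary: Ss)
  case 0
  have "ty 0 w Ss < 2 ^ (k * c)"
    unfolding ty.simps by (intro set_encode_less_two_power) auto
  also have "\<dots> \<le> 2 ^ tower (l - 1)"
    using 0 by (intro power_increasing) auto
  also have "\<dots> = tower (0 + l)"
    using 0 by (cases l) auto
  finally show ?case .
next
  case (Suc n)
  then show ?case
    by (auto intro!: set_encode_less_two_power)
qed

section \<open>What equal types determine\<close>

lemma finite_D: "finite (D n)"
  by (rule finite_subset[of _ "Pow {..<n}"]) (use D_subset in auto)

text \<open>\<open>set_encode\<close> is injective on finite sets only, hence the appeal to
  finiteness of \<open>D\<close>.\<close>

lemma ty_Suc_forth:
  assumes "ty (Suc n) w Ss = ty (Suc n) v Ts" "S \<in> D (length w)"
  obtains T where "T \<in> D (length v)" "ty n w (Ss @ [S]) = ty n v (Ts @ [T])"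
proof -
  have "(\<lambda>S. ty n w (Ss @ [S])) ` D (length w) = (\<lambda>T. ty n v (Ts @ [T])) ` D (length v)"
    using assms(1) by (simp add: set_encode_eq finite_D)
  with assms(2) show ?thesis using that by (metis (no_types, lifting) imageE imageI)
qed

lemma ty_0_eq_atom_iff:
  assumes "ty 0 w Ss = ty 0 v Ts" "i < k" "j < c"
  shows "atom w Ss i j \<longleftrightarrow> atom v Ts i j"
proof -
  have "{q. q < k * c \<and> atom w Ss (q div c) (q mod c)} =
        {q. q < k * c \<and> atom v Ts (q div c) (q mod c)}"
    using assms(1) by (simp add: set_encode_eq)
  then have *: "q < k * c \<Longrightarrow> atom w Ss (q div c) (q mod c) \<longleftrightarrow> atom v Ts (q div c) (q mod c)" for q
    by blast
  \<comment> \<open>The atom for \<open>(i, j)\<close> sits at bit \<open>i * c + j\<close>;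
    division by \<open>c\<close> recovers the pair because \<open>j < c\<close>.\<close>
  have "i * c + j < Suc i * c" using assms(3) by simp
  also have "\<dots> \<le> k * c" using assms(2) by (intro mult_le_mono1) simp
  finally have "i * c + j < k * c" .
  then show ?thesis using *[of "i * c + j"] assms(3) by simp
qed

lemma ty_0_eq_singleton_iff:
  assumes "ty 0 w Ss = ty 0 v Ts" "i < k"
    and "Ss ! i \<in> D (length w)" "Ts ! i \<in> D (length v)"
  shows "is_singleton (Ss ! i) \<longleftrightarrow> is_singleton (Ts ! i)"
proof (cases "Suc k < c")
  case True
  then show ?thesis using ty_0_eq_atom_iff[OF assms(1,2) True] by (simp add: atom_def)
next
  case False
  then show ?thesis using assms singleton_determined by auto
qed

text \<open>A partial isomorphism between lists of sets. Equality of elements is the membership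
  clause with \<open>Ss ! j\<close> a singleton.\<close>

definition agree :: "letter list \<Rightarrow> nat set list \<Rightarrow> letter list \<Rightarrow> nat set list \<Rightarrow> bool" where
  "agree w Ss v Ts \<longleftrightarrow> (\<forall>i<length Ss.
     (is_singleton (Ss ! i) \<longleftrightarrow> is_singleton (Ts ! i)) \<and>
     (\<forall>p q. Ss ! i = {p} \<longrightarrow> Ts ! i = {q} \<longrightarrow>
        w ! p = v ! q \<and>
        (\<forall>j<length Ss. p \<in> Ss ! j \<longleftrightarrow> q \<in> Ts ! j) \<and>
        (\<forall>j<length Ss. \<forall>p' q'. Ss ! j = {p'} \<longrightarrow> Ts ! j = {q'} \<longrightarrow> (p < p' \<longleftrightarrow> q < q'))))"

lemma agree_of_ty_0:
  assumes ty: "ty 0 w Ss = ty 0 v Ts" and len: "length Ss = k" "length Ts = k"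
    and D: "set Ss \<subseteq> D (length w)" "set Ts \<subseteq> D (length v)"
  shows "agree w Ss v Ts"
proof -
  have sing: "is_singleton (Ss ! i) \<longleftrightarrow> is_singleton (Ts ! i)" if "i < k" for i
    using ty_0_eq_singleton_iff[OF ty that] len D that by (metis nth_mem subsetD)
  {
    fix i p q assume i: "i < k" and p: "Ss ! i = {p}" and q: "Ts ! i = {q}"
    have "w ! p = L \<longleftrightarrow> v ! q = L"
      using ty_0_eq_atom_iff[OF ty i k_less_c] p q by (simp add: atom_def)
    then have 1: "w ! p = v ! q" by (metis letter.exhaust)
    have less: "p < p' \<longleftrightarrow> q < q'" if "j < k" "Ss ! j = {p'}" "Ts ! j = {q'}" for j p' q'
      using ty_0_eq_atom_iff[OF ty i, of j] that k_less_c p q by (simp add: atom_def)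
    have greater: "p' < p \<longleftrightarrow> q' < q" if "j < k" "Ss ! j = {p'}" "Ts ! j = {q'}" for j p' q'
      using ty_0_eq_atom_iff[OF ty \<open>j < k\<close>, of i] that k_less_c p q i by (simp add: atom_def)
    have "p \<in> Ss ! j \<longleftrightarrow> q \<in> Ts ! j" if j: "j < k" for j
    proof (cases "is_singleton (Ss ! j)")
      case True
      then obtain p' q' where "Ss ! j = {p'}" "Ts ! j = {q'}"
        using sing[OF j] by (auto simp: is_singleton_def)
      \<comment> \<open>By linearity, \<open>p = p'\<close> iff neither is below the other, so two
        order bits, those of \<open>(i, j)\<close> and \<open>(j, i)\<close>, decide membership in a
        singleton.\<close>
      then show ?thesis using less[OF j, of p' q'] greater[OF j, of p' q'] by auto
    next
      case False
      then show ?thesis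
        using ty_0_eq_atom_iff[OF ty i, of j] sing[OF j] j k_less_c p q by (simp add: atom_def)
    qed
    note 1 this less
  }
  then show ?thesis using sing unfolding agree_def len by blast
qed

lemma
  assumes "agree w Ss v Ts" "i < length Ss"
  shows agree_singleton_iff: "is_singleton (Ss ! i) \<longleftrightarrow> is_singleton (Ts ! i)"
    and agree_letter: "Ss ! i = {p} \<Longrightarrow> Ts ! i = {q} \<Longrightarrow> w ! p = v ! q"
    and agree_mem: "Ss ! i = {p} \<Longrightarrow> Ts ! i = {q} \<Longrightarrow> j < length Ss \<Longrightarrow> p \<in> Ss ! j \<longleftrightarrow> q \<in> Ts ! j"
    and agree_less: "Ss ! i = {p} \<Longrightarrow> Ts ! i = {q} \<Longrightarrow> j < length Ss \<Longrightarrow>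
      Ss ! j = {p'} \<Longrightarrow> Ts ! j = {q'} \<Longrightarrow> p < p' \<longleftrightarrow> q < q'"
  using assms unfolding agree_def by blast+

lemma agree_butlast:
  assumes "agree w (Ss @ [S]) v (Ts @ [T])" "length Ss = length Ts"
  shows "agree w Ss v Ts"
proof -
  have nth: "(Ss @ [S]) ! i = Ss ! i \<and> (Ts @ [T]) ! i = Ts ! i \<and> i < length (Ss @ [S])"
    if "i < length Ss" for i
    using that assms(2) by (simp add: nth_append)
  show ?thesis
    unfolding agree_def
  proof (intro allI impI conjI)
    fix i assume i: "i < length Ss"
    show "is_singleton (Ss ! i) \<longleftrightarrow> is_singleton (Ts ! i)"
      using agree_singleton_iff[OF assms(1), of i] nth[OF i] by metis
    fix p q assume pq: "Ss ! i = {p}" "Ts ! i = {q}"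
    show "w ! p = v ! q"
      using agree_letter[OF assms(1), of i p q] nth[OF i] pq by metis
    fix j assume j: "j < length Ss"
    show "p \<in> Ss ! j \<longleftrightarrow> q \<in> Ts ! j"
      using agree_mem[OF assms(1), of i p q j] nth[OF i] nth[OF j] pq by metis
    fix p' q' assume "Ss ! j = {p'}" "Ts ! j = {q'}"
    then show "p < p' \<longleftrightarrow> q < q'"
      using agree_less[OF assms(1), of i p q j p' q'] nth[OF i] nth[OF j] pq by metis
  qed
qed

text \<open>Rank-0 types describe exactly \<open>k\<close> objects. A shorter list is padded by
  further moves until the rank is used up, and agreement is then restricted to the original
  objects.\<close>

lemma agree_of_ty:
  assumes "ty n w Ss = ty n v Ts" "length Ss + n = k" "length Ts = length Ss" "w \<noteq> []"
    and "set Ss \<subseteq> D (length w)" "set Ts \<subseteq> D (length v)"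
  shows "agree w Ss v Ts"
  using assms
proof (induction n arbitrary: Ss Ts)
  case 0
  then show ?case by (intro agree_of_ty_0) auto
next
  case (Suc n)
  \<comment> \<open>Any object would do as padding; position 0 exists because \<open>w\<close> is
    nonempty.\<close>
  have S: "{0} \<in> D (length w)" using Suc.prems by (intro singleton_in_D) auto
  obtain T where T: "T \<in> D (length v)" "ty n w (Ss @ [{0}]) = ty n v (Ts @ [T])"
    using ty_Suc_forth[OF Suc.prems(1) S] .
  have "agree w (Ss @ [{0}]) v (Ts @ [T])"
    using Suc.prems S T by (intro Suc.IH) auto
  then show ?case using Suc.prems by (auto intro: agree_butlast)
qed

section \<open>Back-and-forth between words of equal type\<close>

definition same_type :: "nat \<Rightarrow> letter list \<Rightarrow> nat set list \<Rightarrow> letter list \<Rightarrow> nat set list \<Rightarrow> bool" where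
  "same_type n w Ss v Ts \<longleftrightarrow> ty n w Ss = ty n v Ts \<and> length Ss + n = k \<and> length Ts = length Ss \<and>
     w \<noteq> [] \<and> v \<noteq> [] \<and> set Ss \<subseteq> D (length w) \<and> set Ts \<subseteq> D (length v)"

lemma same_type_sym: "same_type n w Ss v Ts \<Longrightarrow> same_type n v Ts w Ss"
  by (auto simp: same_type_def)

lemma same_type_agree: "same_type n w Ss v Ts \<Longrightarrow> agree w Ss v Ts"
  by (auto simp: same_type_def intro: agree_of_ty)

text \<open>A move spends one rank and adds one object, so \<open>length Ss + n = k\<close> is
  preserved.\<close>

lemma same_type_forth:
  assumes "same_type (Suc n) w Ss v Ts" "S \<in> D (length w)"
  obtains T where "T \<in> D (length v)" "same_type n w (Ss @ [S]) v (Ts @ [T])"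
proof -
  have "ty (Suc n) w Ss = ty (Suc n) v Ts" using assms by (simp add: same_type_def del: ty.simps)
  from ty_Suc_forth[OF this assms(2)] obtain T where
    "T \<in> D (length v)" "ty n w (Ss @ [S]) = ty n v (Ts @ [T])" .
  then show ?thesis using that assms by (auto simp: same_type_def)
qed

text \<open>This is what allows elements to be played as sets: the types after the move are equal,
  hence the lists agree, and so the answer to a singleton is again a singleton.\<close>

lemma same_type_forth_singleton:
  assumes "same_type (Suc n) w Ss v Ts" "i < length w"
  obtains j where "j < length v" "same_type n w (Ss @ [{i}]) v (Ts @ [{j}])"
proof -
  obtain T where T: "T \<in> D (length v)" "same_type n w (Ss @ [{i}]) v (Ts @ [T])"
    using same_type_forth[OF assms(1) singleton_in_D[OF assms(2)]] .
  have len: "length Ts = length Ss" using assms by (auto simp: same_type_def)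
  have "is_singleton ((Ss @ [{i}]) ! length Ss) \<longleftrightarrow> is_singleton ((Ts @ [T]) ! length Ss)"
    by (intro agree_singleton_iff[OF same_type_agree[OF T(2)]]) simp
  then have "is_singleton T"
    by (metis is_singletonI len nth_append_length)
  then obtain j where "T = {j}" by (auto simp: is_singleton_def)
  with T that D_subset[OF T(1)] show ?thesis by auto
qed

section \<open>Satisfaction is determined by the type\<close>

text \<open>The maps \<open>a\<close> and \<open>b\<close> send variables to indices in the list of distinguished objects.\<close>

definition interprets :: "(nat \<Rightarrow> nat) \<Rightarrow> (nat \<Rightarrow> nat) \<Rightarrow> fm \<Rightarrow> nat set list \<Rightarrow> (nat \<Rightarrow> nat) \<Rightarrow>
    (nat \<Rightarrow> nat set) \<Rightarrow> bool" where
  "interprets a b \<phi> Ss I J \<longleftrightarrow>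
     (\<forall>x\<in>free_vars \<phi>. a x < length Ss \<and> Ss ! a x = {I x}) \<and>
     (\<forall>X\<in>free_set_vars \<phi>. b X < length Ss \<and> Ss ! b X = J X)"

lemma interprets_Ex:
  "interprets a b (Ex x \<phi>) Ss I J \<Longrightarrow>
   interprets (a(x := length Ss)) b \<phi> (Ss @ [{i}]) (I(x := i)) J"
  unfolding interprets_def by (auto simp: nth_append)

lemma interprets_ExSet:
  "interprets a b (ExSet X \<phi>) Ss I J \<Longrightarrow>
   interprets a (b(X := length Ss)) \<phi> (Ss @ [S]) I (J(X := S))"
  unfolding interprets_def by (auto simp: nth_append less_Suc_eq)

lemma interprets_dual:
  "interprets a b (All x \<phi>) = interprets a b (Ex x \<phi>)"
  "interprets a b (AllSet X \<phi>) = interprets a b (ExSet X \<phi>)"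
  by (auto simp: interprets_def fun_eq_iff)

lemma same_type_sat_atomic:
  assumes "same_type n w Ss v Ts"
    and "interprets a b \<phi> Ss I J" "interprets a b \<phi> Ts I' J'"
    and "\<phi> = Eq x y \<or> \<phi> = Less x y \<or> \<phi> = Pred l x \<or> \<phi> = Mem x X"
  shows "sat w I J \<phi> \<longleftrightarrow> sat v I' J' \<phi>"
proof -
  have len: "length Ts = length Ss" using assms(1) by (simp add: same_type_def)
  note agree = same_type_agree[OF assms(1)]
  \<comment> \<open>Stated for an index instead of a set variable, so that it serves
    \<open>Eq\<close> (index \<open>a y\<close>, a singleton) as well as \<open>Mem\<close> (index
    \<open>b X\<close>).\<close>
  have mem: "I x \<in> Ss ! i \<longleftrightarrow> I' x \<in> Ts ! i" if "x \<in> free_vars \<phi>" "i < length Ss" for i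
    using agree_mem[OF agree, of "a x" "I x" "I' x" i] assms(2,3) that
    by (simp add: interprets_def)
  show ?thesis
    using assms(4)
  proof (elim disjE)
    assume \<phi>: "\<phi> = Eq x y"
    have "a y < length Ss" "Ss ! a y = {I y}" "Ts ! a y = {I' y}"
      using assms(2,3) \<phi> by (auto simp: interprets_def)
    then show ?thesis using mem[of "a y"] \<phi> by simp
  next
    assume \<phi>: "\<phi> = Less x y"
    then show ?thesis
      using agree_less[OF agree, of "a x" "I x" "I' x" "a y" "I y" "I' y"] assms(2,3)
      by (simp add: interprets_def)
  next
    assume \<phi>: "\<phi> = Pred l x"
    then show ?thesis
      using agree_letter[OF agree, of "a x" "I x" "I' x"] assms(2,3)
      by (simp add: interprets_def)
  next
    assume \<phi>: "\<phi> = Mem x X"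
    then show ?thesis
      using mem[of "b X"] assms(2,3) by (simp add: interprets_def)
  qed
qed

text \<open>The induction claim as a predicate, so that each quantifier gets its own lemma. The rank
  \<open>n\<close> may exceed \<open>qr \<phi>\<close>, since a conjunct or disjunct can have
  smaller rank than the whole.\<close>

definition type_invariant :: "fm \<Rightarrow> bool" where
  "type_invariant \<phi> \<longleftrightarrow> (\<forall>n a b w Ss I J v Ts I' J'. qr \<phi> \<le> n \<longrightarrow> same_type n w Ss v Ts \<longrightarrow>
     interprets a b \<phi> Ss I J \<longrightarrow> interprets a b \<phi> Ts I' J' \<longrightarrow> sat w I J \<phi> = sat v I' J' \<phi>)"

lemma type_invariantI:
  "(\<And>n a b w Ss I J v Ts I' J'. qr \<phi> \<le> n \<Longrightarrow> same_type n w Ss v Ts \<Longrightarrow>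
     interprets a b \<phi> Ss I J \<Longrightarrow> interprets a b \<phi> Ts I' J' \<Longrightarrow> sat w I J \<phi> = sat v I' J' \<phi>) \<Longrightarrow>
   type_invariant \<phi>"
  unfolding type_invariant_def by blast

lemma type_invariantD:
  "type_invariant \<phi> \<Longrightarrow> qr \<phi> \<le> n \<Longrightarrow> same_type n w Ss v Ts \<Longrightarrow>
   interprets a b \<phi> Ss I J \<Longrightarrow> interprets a b \<phi> Ts I' J' \<Longrightarrow> sat w I J \<phi> = sat v I' J' \<phi>"
  unfolding type_invariant_def by blast

text \<open>Concluding with an equivalence of truth values makes the same lemma usable for
  \<open>Ex\<close> and \<open>All\<close>. The new object has index \<open>length Ss\<close> in
  both lists, as their lengths coincide.\<close>

lemma sat_forth_Ex:
  assumes "type_invariant \<phi>"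
    and "Suc (qr \<phi>) \<le> n" "same_type n w Ss v Ts"
    and "interprets a b (Ex x \<phi>) Ss I J" "interprets a b (Ex x \<phi>) Ts I' J'"
    and "i < length w"
  shows "\<exists>j<length v. sat w (I(x := i)) J \<phi> \<longleftrightarrow> sat v (I'(x := j)) J' \<phi>"
proof -
  obtain n' where n: "n = Suc n'" "qr \<phi> \<le> n'" using assms(2) by (cases n) auto
  obtain j where j: "j < length v" "same_type n' w (Ss @ [{i}]) v (Ts @ [{j}])"
    using same_type_forth_singleton assms(3,6) n(1) by blast
  have len: "length Ts = length Ss" using assms(3) by (simp add: same_type_def)
  have "sat w (I(x := i)) J \<phi> \<longleftrightarrow> sat v (I'(x := j)) J' \<phi>"
    using type_invariantD[OF assms(1) n(2) j(2) interprets_Ex[OF assms(4)]] interprets_Ex[OF assms(5), of j] len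
    by simp
  with j show ?thesis by blast
qed

lemma sat_forth_ExSet:
  assumes "type_invariant \<phi>"
    and "Suc (qr \<phi>) \<le> n" "same_type n w Ss v Ts"
    and "interprets a b (ExSet X \<phi>) Ss I J" "interprets a b (ExSet X \<phi>) Ts I' J'"
    and "S \<in> D (length w)"
  shows "\<exists>T\<subseteq>{..<length v}. sat w I (J(X := S)) \<phi> \<longleftrightarrow> sat v I' (J'(X := T)) \<phi>"
proof -
  obtain n' where n: "n = Suc n'" "qr \<phi> \<le> n'" using assms(2) by (cases n) auto
  obtain T where T: "T \<in> D (length v)" "same_type n' w (Ss @ [S]) v (Ts @ [T])"
    using same_type_forth assms(3,6) n(1) by blast
  have len: "length Ts = length Ss" using assms(3) by (simp add: same_type_def)
  have "sat w I (J(X := S)) \<phi> \<longleftrightarrow> sat v I' (J'(X := T)) \<phi>"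
    using type_invariantD[OF assms(1) n(2) T(2) interprets_ExSet[OF assms(4)]] interprets_ExSet[OF assms(5), of T] len
    by simp
  with D_subset[OF T(1)] show ?thesis by blast
qed

lemma type_invariant_Ex:
  assumes "type_invariant \<phi>"
  shows "type_invariant (Ex x \<phi>)"
proof (rule type_invariantI)
  fix n a b w Ss I J v Ts I' J'
  assume "qr (Ex x \<phi>) \<le> n" and same: "same_type n w Ss v Ts"
    and "interprets a b (Ex x \<phi>) Ss I J" "interprets a b (Ex x \<phi>) Ts I' J'"
  then have qr: "Suc (qr \<phi>) \<le> n"
    and int: "interprets a b (Ex x \<phi>) Ss I J" "interprets a b (Ex x \<phi>) Ts I' J'"
    by (simp_all)
  note forth = sat_forth_Ex[OF assms(1) qr]
  \<comment> \<open>Exchanging the two words turns the forth property into the back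
    property.\<close>
  show "sat w I J (Ex x \<phi>) = sat v I' J' (Ex x \<phi>)"
    using forth[OF same int] forth[OF same_type_sym[OF same] int(2,1)]
    unfolding sat.simps by metis
qed

lemma type_invariant_All:
  assumes "type_invariant \<phi>"
  shows "type_invariant (All x \<phi>)"
proof (rule type_invariantI)
  fix n a b w Ss I J v Ts I' J'
  assume "qr (All x \<phi>) \<le> n" and same: "same_type n w Ss v Ts"
    and "interprets a b (All x \<phi>) Ss I J" "interprets a b (All x \<phi>) Ts I' J'"
  then have qr: "Suc (qr \<phi>) \<le> n"
    and int: "interprets a b (Ex x \<phi>) Ss I J" "interprets a b (Ex x \<phi>) Ts I' J'"
    by (simp_all add: interprets_dual)
  note forth = sat_forth_Ex[OF assms(1) qr]
  show "sat w I J (All x \<phi>) = sat v I' J' (All x \<phi>)"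
    using forth[OF same int] forth[OF same_type_sym[OF same] int(2,1)]
    unfolding sat.simps by metis
qed

lemma type_invariant_ExSet:
  assumes "type_invariant \<phi>" "\<And>n. D n = Pow {..<n}"
  shows "type_invariant (ExSet X \<phi>)"
proof (rule type_invariantI)
  fix n a b w Ss I J v Ts I' J'
  assume "qr (ExSet X \<phi>) \<le> n" and same: "same_type n w Ss v Ts"
    and "interprets a b (ExSet X \<phi>) Ss I J" "interprets a b (ExSet X \<phi>) Ts I' J'"
  then have qr: "Suc (qr \<phi>) \<le> n"
    and int: "interprets a b (ExSet X \<phi>) Ss I J" "interprets a b (ExSet X \<phi>) Ts I' J'"
    by (simp_all)
  \<comment> \<open>A set quantifier ranges over all subsets of the domain, so each of them has to
    be an admissible move.\<close>
  have D: "S \<in> D m" if "S \<subseteq> {..<m}" for S m using that assms(2) by simp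
  note forth = sat_forth_ExSet[OF assms(1) qr]
  show "sat w I J (ExSet X \<phi>) = sat v I' J' (ExSet X \<phi>)"
    using forth[OF same int D] forth[OF same_type_sym[OF same] int(2,1) D]
    unfolding sat.simps by metis
qed

lemma type_invariant_AllSet:
  assumes "type_invariant \<phi>" "\<And>n. D n = Pow {..<n}"
  shows "type_invariant (AllSet X \<phi>)"
proof (rule type_invariantI)
  fix n a b w Ss I J v Ts I' J'
  assume "qr (AllSet X \<phi>) \<le> n" and same: "same_type n w Ss v Ts"
    and "interprets a b (AllSet X \<phi>) Ss I J" "interprets a b (AllSet X \<phi>) Ts I' J'"
  then have qr: "Suc (qr \<phi>) \<le> n"
    and int: "interprets a b (ExSet X \<phi>) Ss I J" "interprets a b (ExSet X \<phi>) Ts I' J'"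
    by (simp_all add: interprets_dual)
  have D: "S \<in> D m" if "S \<subseteq> {..<m}" for S m using that assms(2) by simp
  note forth = sat_forth_ExSet[OF assms(1) qr]
  show "sat w I J (AllSet X \<phi>) = sat v I' J' (AllSet X \<phi>)"
    using forth[OF same int D] forth[OF same_type_sym[OF same] int(2,1) D]
    unfolding sat.simps by metis
qed

text \<open>Formulas with a set quantifier are not first-order, so in those cases the assumption
  yields the full powerset.\<close>

lemma type_invariant:
  assumes "first_order \<phi> \<or> (\<forall>n. D n = Pow {..<n})"
  shows "type_invariant \<phi>"
  using assms
proof (induction \<phi>)
  case (Eq x y)
  show ?case by (intro type_invariantI, erule same_type_sat_atomic) auto
next
  case (Less x y)
  show ?case by (intro type_invariantI, erule same_type_sat_atomic) auto
next
  case (Pred l x)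
  show ?case by (intro type_invariantI, erule same_type_sat_atomic) auto
next
  case (Mem x X)
  show ?case by (intro type_invariantI, erule same_type_sat_atomic) auto
next
  case (Neg \<phi>)
  then show ?case by (auto simp: type_invariant_def interprets_def)
next
  case (Conj \<phi> \<psi>)
  then have inv: "type_invariant \<phi>" "type_invariant \<psi>" by auto
  show ?case
  proof (rule type_invariantI)
    fix n a b w Ss I J v Ts I' J'
    assume "qr (Conj \<phi> \<psi>) \<le> n" "same_type n w Ss v Ts"
      "interprets a b (Conj \<phi> \<psi>) Ss I J" "interprets a b (Conj \<phi> \<psi>) Ts I' J'"
    then show "sat w I J (Conj \<phi> \<psi>) = sat v I' J' (Conj \<phi> \<psi>)"
      using inv[THEN type_invariantD, of n w Ss v Ts a b I J I' J']
      by (simp add: interprets_def)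
  qed
next
  case (Disj \<phi> \<psi>)
  then have inv: "type_invariant \<phi>" "type_invariant \<psi>" by auto
  show ?case
  proof (rule type_invariantI)
    fix n a b w Ss I J v Ts I' J'
    assume "qr (Disj \<phi> \<psi>) \<le> n" "same_type n w Ss v Ts"
      "interprets a b (Disj \<phi> \<psi>) Ss I J" "interprets a b (Disj \<phi> \<psi>) Ts I' J'"
    then show "sat w I J (Disj \<phi> \<psi>) = sat v I' J' (Disj \<phi> \<psi>)"
      using inv[THEN type_invariantD, of n w Ss v Ts a b I J I' J']
      by (simp add: interprets_def)
  qed
next
  case (Ex x \<phi>)
  then show ?case by (auto intro: type_invariant_Ex)
next
  case (All x \<phi>)
  then show ?case by (auto intro: type_invariant_All)
next
  case (ExSet X \<phi>)
  then have D: "\<forall>n. D n = Pow {..<n}" by simp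
  have "type_invariant \<phi>" using D by (intro ExSet.IH disjI2)
  then show ?case using D by (intro type_invariant_ExSet) blast+
next
  case (AllSet X \<phi>)
  then have D: "\<forall>n. D n = Pow {..<n}" by simp
  have "type_invariant \<phi>" using D by (intro AllSet.IH disjI2)
  then show ?case using D by (intro type_invariant_AllSet) blast+
qed

text \<open>The game starts with no objects and \<open>k\<close> moves left; a sentence has no free
  variables, so the empty lists interpret it vacuously.\<close>

lemma ty_eq_models_iff:
  assumes "first_order \<phi> \<or> (\<forall>n. D n = Pow {..<n})" "qr \<phi> \<le> k" "sentence \<phi>"
    and "w \<in> words" "v \<in> words" "ty k w [] = ty k v []"
  shows "models w \<phi> \<longleftrightarrow> models v \<phi>"
  unfolding models_def
  by (rule type_invariantD[OF type_invariant[OF assms(1)] assms(2), where Ss = "[]" and Ts = "[]"])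
    (use assms(3-) in \<open>auto simp: same_type_def interprets_def sentence_def words_def\<close>)

end

section \<open>Counting equivalence classes\<close>

lemma classes_bound:
  fixes f :: "letter list \<Rightarrow> nat"
  assumes less: "\<And>w. w \<in> words \<Longrightarrow> f w < N"
    and eq: "\<And>w v \<phi>. w \<in> words \<Longrightarrow> v \<in> words \<Longrightarrow> f w = f v \<Longrightarrow> \<phi> \<in> F \<Longrightarrow> sentence \<phi> \<Longrightarrow>
      models w \<phi> \<longleftrightarrow> models v \<phi>"
  shows "finite (classes F) \<and> num_classes F \<le> N"
proof -
  let ?R = "equiv_rel F"
  \<comment> \<open>Each number below \<open>N\<close> is sent to the class of a chosen preimage.
    Values that \<open>f\<close> does not attain give arbitrary sets, which is harmless for an
    inclusion.\<close>
  have "classes F \<subseteq> (\<lambda>m. ?R `` {inv_into words f m}) ` {..<N}"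
  proof
    fix C assume "C \<in> classes F"
    then obtain w where w: "w \<in> words" "C = ?R `` {w}"
      by (auto simp: classes_def elim: quotientE)
    define v where "v = inv_into words f (f w)"
    have v: "v \<in> words" "f v = f w"
      using w by (auto simp: v_def inv_into_into f_inv_into_f)
    have "(w, v) \<in> ?R"
      using eq[OF w(1) v(1) v(2)[symmetric]] w v by (simp add: equiv_rel_def)
    then have "C = ?R `` {v}"
      using w equiv_class_eq[OF equiv_equiv_rel] by simp
    then show "C \<in> (\<lambda>m. ?R `` {inv_into words f m}) ` {..<N}"
      using less[OF w(1)] by (auto simp: v_def)
  qed
  from surj_card_le[OF _ this] finite_subset[OF this] show ?thesis
    by (simp add: num_classes_def)
qed

section \<open>Towers and the final bounds\<close>

lemma less_tower: "n < tower n"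
proof (induction n)
  case (Suc n)
  then have "Suc n \<le> tower n" by simp
  also have "\<dots> < 2 ^ tower n" by (rule less_exp)
  finally show ?case by simp
qed simp

text \<open>By \<open>less_tower\<close> towers are unbounded, so the \<open>LEAST\<close> in
  \<open>log_star\<close> is attained.\<close>

lemma tower_log_star: "x \<le> real (tower (log_star x))"
proof -
  obtain n where "x < real n" using reals_Archimedean2 by blast
  then have "x \<le> real (tower n)" using less_tower[of n] by linarith
  then show ?thesis unfolding log_star_def by (rule LeastI)
qed

lemma twr_of_nat: "twr (real m + real n + 1) = tower (m + (n + 1))"
proof -
  have "real m + real n + 1 = real (m + (n + 1))" by simp
  then show ?thesis unfolding twr_def by (simp only: ceiling_of_nat nat_int)
qed

lemma (in object_types) classes_bound_twr:
  assumes "\<And>\<phi>. \<phi> \<in> F \<Longrightarrow> (first_order \<phi> \<or> (\<forall>n. D n = Pow {..<n})) \<and> qr \<phi> \<le> k"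
    and "real (k * c) \<le> x"
  shows "finite (classes F) \<and> num_classes F \<le> twr (real k + real (log_star x) + 1)"
proof -
  have "k * c \<le> tower (log_star x)"
    using tower_log_star[of x] assms(2) by linarith
  \<comment> \<open>Here \<open>l\<close> is \<open>log_star x + 1\<close>: one storey above a tower
    that bounds the number of bits.\<close>
  then have "ty k w [] < tower (k + (log_star x + 1))" for w
    by (intro ty_less) auto
  then show ?thesis
    unfolding twr_of_nat
  proof (rule classes_bound)
    fix w v \<phi> assume "\<phi> \<in> F" "w \<in> words" "v \<in> words" "ty k w [] = ty k v []" "sentence \<phi>"
    then show "models w \<phi> \<longleftrightarrow> models v \<phi>"
      using assms(1)[of \<phi>] by (intro ty_eq_models_iff) blast+
  qed
qed

theorem theorem2:
  fixes k :: nat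
  shows "(finite (classes (FO k)) \<and>
      num_classes (FO k) \<le> twr (real k + real (log_star (real k ^ 2 + real k)) + 1)) \<and>
    (finite (classes (MSO k)) \<and>
      num_classes (MSO k) \<le> twr (real k + real (log_star ((real k + 1) ^ 2)) + 1))"
proof (rule conjI)
  \<comment> \<open>All objects are singletons, so no singleton bit is stored and the number of bits
    is \<open>k * (k + 1)\<close>, exactly the argument of \<open>log_star\<close>.\<close>
  interpret fo: object_types "\<lambda>n. (\<lambda>i. {i}) ` {..<n}" k "k + 1"
    by unfold_locales auto
  show "finite (classes (FO k)) \<and>
      num_classes (FO k) \<le> twr (real k + real (log_star (real k ^ 2 + real k)) + 1)"
    by (rule fo.classes_bound_twr) (auto simp: FO_def power2_eq_square algebra_simps)
next
  \<comment> \<open>With the singleton bit there are \<open>k * (k + 2)\<close> bits, one less than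
    \<open>(k + 1) ^ 2\<close>.\<close>
  interpret mso: object_types "\<lambda>n. Pow {..<n}" k "k + 2"
    by unfold_locales auto
  show "finite (classes (MSO k)) \<and>
      num_classes (MSO k) \<le> twr (real k + real (log_star ((real k + 1) ^ 2)) + 1)"
    by (rule mso.classes_bound_twr) (auto simp: MSO_def power2_eq_square algebra_simps)
qed

end
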